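(* Let $r$ be an integer with $r \geq 2$. There exists an induced unit-distance graph $J$ containing two non-adjacent vertices $a,b$ with $\deg(a)=\deg(b)=r-1$, such that every vertex $v \in V(J)\setminus\{a,b\}$ satisfies $\deg(v)=r$.
   Context: $G(\mathbb{R}^2,1)$ denotes the graph with vertex set $\mathbb{R}^2$ in which two points are adjacent if and only if their Euclidean distance is exactly $1$. A graph is an induced unit-distance graph if it is isomorphic to an induced subgraph of $G(\mathbb{R}^2,1)$, i.e. it can be drawn with vertices at distinct points of the plane so that two vertices are at distance exactly $1$ if and only if they are adjacent. *)

theory Defs
  imports "HOL-Analysis.Analysis" "Graph_Theory.Graph_Theory"
begin

text \<open>
  Undirected simple graphs are symmetric loop-free digraphs without parallel arcs: an edge
  \<open>{u, v}\<close> is the pair of arcs \<open>(u, v)\<close>, \<open>(v, u)\<close>.  The locale \<open>pair_graph\<close> describes the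
  finite ones; the degree of a vertex is its \<open>out_degree\<close>.
\<close>

definition plane_unit_graph :: "(real^2) pair_pre_digraph" where
  "plane_unit_graph = \<lparr> pverts = UNIV, parcs = {(x, y). dist x y = 1} \<rparr>"

definition induced_unit_distance_graph :: "'a pair_pre_digraph \<Rightarrow> bool" where
  "induced_unit_distance_graph J \<longleftrightarrow>
     (\<exists>H. induced_subgraph H (with_proj plane_unit_graph) \<and> digraph_iso (with_proj J) H)"

lemma induced_unit_distance_graph_iff_drawing:
  fixes J :: "'a pair_pre_digraph"
  assumes "pair_wf_digraph J"
  shows "induced_unit_distance_graph J \<longleftrightarrow>
    (\<exists>f :: _ \<Rightarrow> real^2. inj_on f (pverts J) \<and>
      (\<forall>u\<in>pverts J. \<forall>v\<in>pverts J. (u, v) \<in> parcs J \<longleftrightarrow> dist (f u) (f v) = 1))"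
    (is "_ \<longleftrightarrow> ?R")
proof
  interpret J: pair_wf_digraph J by fact
  assume "induced_unit_distance_graph J"
  then obtain H h where ind: "induced_subgraph H (with_proj plane_unit_graph)"
    and iso: "pre_digraph.digraph_isomorphism (with_proj J) h" and H: "H = app_iso h (with_proj J)"
    unfolding induced_unit_distance_graph_def digraph_iso_def by blast
  let ?f = "iso_verts h"
  have inj: "inj_on ?f (pverts J)"
    and ends: "\<And>a. a \<in> parcs J \<Longrightarrow>
      ?f (fst a) = iso_tail h (iso_arcs h a) \<and> ?f (snd a) = iso_head h (iso_arcs h a)"
    using iso by (auto simp: pre_digraph.digraph_isomorphism_def)
  have th: "iso_tail h = fst" "iso_head h = snd"
    using ind by (auto simp: H induced_subgraph_def subgraph_def compatible_def app_iso_def)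
  have arcs: "iso_arcs h ` parcs J =
      {(x, y). dist x y = 1 \<and> x \<in> ?f ` pverts J \<and> y \<in> ?f ` pverts J}"
    using ind by (auto simp: H induced_subgraph_def app_iso_def plane_unit_graph_def)
  have im: "iso_arcs h a = (?f (fst a), ?f (snd a))" if "a \<in> parcs J" for a
    using ends[OF that] by (simp add: th)
  have "(u, v) \<in> parcs J \<longleftrightarrow> dist (?f u) (?f v) = 1" if uv: "u \<in> pverts J" "v \<in> pverts J" for u v
  proof
    assume "(u, v) \<in> parcs J"
    then have "(?f u, ?f v) \<in> iso_arcs h ` parcs J" using im by force
    then show "dist (?f u) (?f v) = 1" by (simp add: arcs)
  next
    assume "dist (?f u) (?f v) = 1"
    then have "(?f u, ?f v) \<in> iso_arcs h ` parcs J" using uv by (simp add: arcs)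
    then obtain a where a: "a \<in> parcs J" "(?f u, ?f v) = (?f (fst a), ?f (snd a))"
      using im by force
    then have "fst a = u" "snd a = v"
      using inj uv J.arc_fst_in_verts J.arc_snd_in_verts by (auto dest: inj_onD)
    with a show "(u, v) \<in> parcs J" by auto
  qed
  with inj show ?R by blast
next
  interpret J: pair_wf_digraph J by fact
  assume ?R
  then obtain f :: "'a \<Rightarrow> real^2" where inj: "inj_on f (pverts J)"
    and adj: "\<And>u v. u \<in> pverts J \<Longrightarrow> v \<in> pverts J \<Longrightarrow> (u, v) \<in> parcs J \<longleftrightarrow> dist (f u) (f v) = 1"
    by blast
  define h where "h = \<lparr> iso_verts = f, iso_arcs = map_prod f f, iso_head = snd, iso_tail = fst \<rparr>"
  have sub: "parcs J \<subseteq> pverts J \<times> pverts J" using J.in_arcsD1 J.in_arcsD2 by auto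
  have "inj_on (map_prod f f) (parcs J)"
    using map_prod_inj_on[OF inj inj] sub by (rule inj_on_subset)
  then have "pre_digraph.digraph_isomorphism (with_proj J) h"
    using inj J.wf_digraph_axioms by (auto simp: pre_digraph.digraph_isomorphism_def h_def)
  moreover have "induced_subgraph (app_iso h (with_proj J)) (with_proj plane_unit_graph)"
  proof -
    have "map_prod f f ` parcs J =
        {(x, y). dist x y = 1 \<and> x \<in> f ` pverts J \<and> y \<in> f ` pverts J}"
      using adj sub by (force simp: image_iff)
    then show ?thesis
      by (auto simp: induced_subgraph_def subgraph_def compatible_def app_iso_def
          plane_unit_graph_def h_def wf_digraph_def)
  qed
  ultimately show "induced_unit_distance_graph J"
    unfolding induced_unit_distance_graph_def digraph_iso_def by blast
qed

end

theory Submission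
  imports Defs "HOL-Computational_Algebra.Polynomial"
begin

text \<open>
  Take the projection to the plane of the \<open>r\<close>-dimensional cube along generic unit vectors and
  delete the vertex at the origin.  Its \<open>r\<close> former neighbours are the only vertices whose degree
  drops to \<open>r - 1\<close>.  Rotate a second such punctured cube by \<open>\<pi>/3\<close> about the origin; it uses the
  same unit vectors except for the last one.  A former neighbour \<open>u\<^sub>i\<close> of the origin and its
  rotated image are then at distance \<open>1\<close>, which repairs the degrees of all of them but one in
  each copy.  Genericity of the unit vectors excludes all other unit distances.
\<close>

section \<open>Generic unit vectors in the complex plane\<close>

lemma finite_unit_circle_inter:
  fixes s :: complex
  assumes "s \<noteq> 0"
  shows "finite {w. norm w = 1 \<and> norm (s + w) = k}"
proof (rule finite_subset)
  \<comment> \<open>On the unit circle \<open>cnj w\<close> is the inverse of \<open>w\<close>, so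
    multiplying the equation for the squared norm of \<open>s + w\<close> by \<open>w\<close> gives
    this quadratic in \<open>w\<close>. It is nonzero because \<open>s\<close> is.\<close>
  let ?p = "[:s, s * cnj s + 1 - of_real (k\<^sup>2), cnj s:]"
  show "finite {w. poly ?p w = 0}"
    using assms by (intro poly_roots_finite) auto
  show "{w. norm w = 1 \<and> norm (s + w) = k} \<subseteq> {w. poly ?p w = 0}"
  proof
    fix w assume "w \<in> {w. norm w = 1 \<and> norm (s + w) = k}"
    then have w: "norm w = 1" and k: "k = norm (s + w)"
      by auto
    have 1: "w * cnj w = 1"
      using w by (simp flip: complex_norm_square)
    have 2: "(s + w) * (cnj s + cnj w) = of_real (k\<^sup>2)"
      unfolding k by (simp only: complex_cnj_add[symmetric] complex_norm_square)
    have "poly ?p w = s + w * (s * cnj s + 1 - (s + w) * (cnj s + cnj w) + w * cnj s)"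
      unfolding 2 by (simp add: algebra_simps)
    also have "\<dots> = (s + w) * (1 - w * cnj w)"
      by (simp add: algebra_simps)
    finally show "w \<in> {w. poly ?p w = 0}"
      by (simp add: 1)
  qed
qed

lemma infinite_unit_circle: "infinite {w :: complex. norm w = 1}"
proof
  assume "finite {w :: complex. norm w = 1}"
  moreover have "cis ` {0..1} \<subseteq> {w. norm w = 1}"
    by auto
  ultimately have "finite (cis ` {0..1})"
    using finite_subset by blast
  moreover have "inj_on cis {0..1}"
  proof (rule inj_onI)
    fix x y :: real
    assume xy: "x \<in> {0..1}" "y \<in> {0..1}" "cis x = cis y"
    then have "cos x = cos y"
      by (metis cis.sel(1))
    \<comment> \<open>Angles in [0, 1] thus lie in [0, pi], where \<open>cos\<close> is
      injective.\<close>
    moreover have "1 \<le> pi"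
      using pi_gt3 by simp
    ultimately show "x = y"
      using xy(1,2) by (simp add: cos_inj_pi)
  qed
  ultimately have "finite {0..1::real}"
    using finite_imageD by blast
  then show False
    using infinite_Icc[of "0::real" 1] by simp
qed

text \<open>The vectors are chosen one after another, each avoiding only finitely many points of the
  infinite unit circle. Applied to differences of cube corners, this rules out accidental
  coincidences and unit distances.\<close>

lemma generic_unit_vectors:
  fixes C :: "complex set"
  assumes "finite C" and unit: "\<And>c. c \<in> C \<Longrightarrow> c = 0 \<or> norm c = 1"
  shows "\<exists>u :: nat \<Rightarrow> complex. \<forall>c. (\<forall>i<n. c i \<in> C) \<longrightarrow>
    ((\<Sum>i<n. c i * u i) = 0 \<longleftrightarrow> card {i. i < n \<and> c i \<noteq> 0} = 0) \<and>
    (norm (\<Sum>i<n. c i * u i) = 1 \<longleftrightarrow> card {i. i < n \<and> c i \<noteq> 0} = 1)"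
proof (induction n)
  case 0
  show ?case by simp
next
  case (Suc n)
  then obtain u where u: "\<forall>c. (\<forall>i<n. c i \<in> C) \<longrightarrow>
    ((\<Sum>i<n. c i * u i) = 0 \<longleftrightarrow> card {i. i < n \<and> c i \<noteq> 0} = 0) \<and>
    (norm (\<Sum>i<n. c i * u i) = 1 \<longleftrightarrow> card {i. i < n \<and> c i \<noteq> 0} = 1)" ..
  have u0: "\<forall>i<n. c i \<in> C \<Longrightarrow>
      (\<Sum>i<n. c i * u i) = 0 \<longleftrightarrow> card {i. i < n \<and> c i \<noteq> 0} = 0"
    and u1: "\<forall>i<n. c i \<in> C \<Longrightarrow>
      norm (\<Sum>i<n. c i * u i) = 1 \<longleftrightarrow> card {i. i < n \<and> c i \<noteq> 0} = 1" for c
    using u by simp_all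
  define partial_sums where "partial_sums = (\<lambda>c. \<Sum>i<n. c i * u i) ` ({..<n} \<rightarrow>\<^sub>E C)"
  have "finite partial_sums"
    unfolding partial_sums_def using \<open>finite C\<close> by (intro finite_imageI finite_PiE) auto
  have partial_sums: "(\<Sum>i<n. c i * u i) \<in> partial_sums" if "\<forall>i<n. c i \<in> C" for c
    unfolding partial_sums_def using that
    by (intro image_eqI[of _ _ "restrict c {..<n}"]) auto
  \<comment> \<open>The finiteness lemma speaks of the unit vector \<open>c * w\<close>; dividing by
    \<open>c\<close> returns to \<open>w\<close>. The partial sum 0 imposes no condition, since
    \<open>c * w\<close> alone always has norm 1.\<close>
  define bad where "bad = (\<Union>s\<in>partial_sums - {0}. \<Union>c\<in>C - {0}. \<Union>k\<in>{0, 1}.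
    (\<lambda>w. w / c) ` {w. norm w = 1 \<and> norm (s + w) = k})"
  have "finite bad"
    unfolding bad_def using \<open>finite partial_sums\<close> \<open>finite C\<close>
    by (intro finite_UN_I finite_imageI finite_unit_circle_inter) auto
  then have "\<not> {w. norm w = 1} \<subseteq> bad"
    using infinite_unit_circle finite_subset by blast
  then obtain w where w: "norm w = 1" "w \<notin> bad"
    by auto
  have avoid: "norm (s + c * w) \<noteq> k"
    if "s \<in> partial_sums" "s \<noteq> 0" "c \<in> C" "c \<noteq> 0" "k \<in> {0, 1}" for s c k
  proof
    assume "norm (s + c * w) = k"
    moreover have "norm (c * w) = 1"
      using w unit that by (auto simp: norm_mult)
    moreover have "w = (c * w) / c"
      using that by simp
    ultimately have "w \<in> bad"
      unfolding bad_def using that by blast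
    then show False
      using w by simp
  qed
  have "((\<Sum>i<Suc n. c i * (u(n := w)) i) = 0 \<longleftrightarrow> card {i. i < Suc n \<and> c i \<noteq> 0} = 0) \<and>
    (norm (\<Sum>i<Suc n. c i * (u(n := w)) i) = 1 \<longleftrightarrow> card {i. i < Suc n \<and> c i \<noteq> 0} = 1)"
    if c: "\<forall>i<Suc n. c i \<in> C" for c
  proof -
    let ?s = "\<Sum>i<n. c i * u i" and ?N = "{i. i < n \<and> c i \<noteq> 0}"
    have cn: "\<forall>i<n. c i \<in> C" "c n \<in> C"
      using c by auto
    have sum: "(\<Sum>i<Suc n. c i * (u(n := w)) i) = ?s + c n * w"
      by simp
    have supp: "{i. i < Suc n \<and> c i \<noteq> 0} = (if c n = 0 then ?N else insert n ?N)"
      by (auto simp: less_Suc_eq)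
    show ?thesis
    proof (cases "c n = 0")
      case True
      then show ?thesis
        unfolding sum supp using u0[OF cn(1)] u1[OF cn(1)] by simp
    next
      case False
      then have nw: "norm (c n * w) = 1"
        using unit[OF cn(2)] w by (simp add: norm_mult)
      have card: "card {i. i < Suc n \<and> c i \<noteq> 0} = Suc (card ?N)"
        unfolding supp using False by simp
      show ?thesis
      proof (cases "?s = 0")
        case True
        then show ?thesis
          unfolding sum card using u0[OF cn(1)] nw by auto
      next
        \<comment> \<open>At least two coefficients are nonzero here, so the extended sum must have
          norm neither 0 nor 1; \<open>w\<close> was chosen for this.\<close>
        case s: False
        then have "card ?N \<noteq> 0"
          using u0[OF cn(1)] by simp
        then show ?thesis
          unfolding sum card
          using avoid[OF partial_sums[OF cn(1)] s cn(2) False, of 0]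
            avoid[OF partial_sums[OF cn(1)] s cn(2) False, of 1] by auto
      qed
    qed
  qed
  then show ?case
    by blast
qed

section \<open>The two punctured cubes as an abstract graph, and its degrees\<close>

lemma card_sym_diff_eq_1_iff: "card (sym_diff S T) = 1 \<longleftrightarrow> (\<exists>i. T = sym_diff S {i})"
proof -
  have "sym_diff S T = {i} \<longleftrightarrow> T = sym_diff S {i}" for i
    by blast
  then show ?thesis
    by (simp add: card_1_singleton_iff)
qed

lemma inj_sym_diff_singleton: "inj (\<lambda>i. sym_diff S {i})"
  by (rule injI) blast

text \<open>The points 0, 1 and \<open>cis (pi / 3)\<close> form an equilateral triangle. Hence a
  unit vector is at distance 1 from its rotated image.\<close>

lemma norm_1_minus_cis_pi_third: "norm (1 - cis (pi / 3)) = 1"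
  by (simp add: cmod_def cos_60 sin_60 power_divide power2_eq_square)

text \<open>
  The vertex \<open>(h, S)\<close> is the corner \<open>S\<close> of the copy \<open>h\<close> of the punctured cube, whose
  directions are \<open>0, \<dots>, r - 2\<close> together with a private one.
\<close>

definition directions :: "nat \<Rightarrow> bool \<Rightarrow> nat set" where
  "directions r h = insert (if h then r else r - 1) {..<r - 1}"

definition corners :: "nat \<Rightarrow> (bool \<times> nat set) set" where
  "corners r = {(h, S). S \<noteq> {} \<and> S \<subseteq> directions r h}"

text \<open>The set whose size is tested is the support of the difference of the two positions,
  written in the vectors \<open>u i\<close>. Within a copy common directions cancel; across copies
  they keep the nonzero coefficient \<open>1 - cis (pi / 3)\<close> up to sign.\<close>

definition corner_adj :: "bool \<times> nat set \<Rightarrow> bool \<times> nat set \<Rightarrow> bool" where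
  "corner_adj v w \<longleftrightarrow> card (if fst v = fst w then sym_diff (snd v) (snd w) else snd v \<union> snd w) = 1"

definition corner_pos :: "(nat \<Rightarrow> complex) \<Rightarrow> bool \<times> nat set \<Rightarrow> complex" where
  "corner_pos u v = (if fst v then cis (pi / 3) else 1) * (\<Sum>i\<in>snd v. u i)"

lemma finite_directions: "finite (directions r h)"
  by (simp add: directions_def)

lemma card_directions: "r \<ge> 1 \<Longrightarrow> card (directions r h) = r"
  by (auto simp: directions_def)

lemma finite_corners: "finite (corners r)"
proof (rule finite_subset)
  show "corners r \<subseteq> UNIV \<times> Pow (directions r False \<union> directions r True)"
    by (auto simp: corners_def directions_def split: if_splits)
qed (simp add: finite_directions)

text \<open>Within a copy an edge flips one direction, and \<open>S \<noteq> {i}\<close> excludes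
  the flip to the deleted origin. Across copies, two nonempty sets with a singleton union are equal,
  and their element must be a direction shared by both copies.\<close>

lemma corner_neighbours:
  assumes "r \<ge> 1" "(h, S) \<in> corners r"
  shows "{w \<in> corners r. corner_adj (h, S) w} =
    (\<lambda>i. (h, sym_diff S {i})) ` {i \<in> directions r h. S \<noteq> {i}} \<union>
    (if \<exists>j<r - 1. S = {j} then {(\<not> h, S)} else {})"
proof -
  have S: "S \<noteq> {}" "S \<subseteq> directions r h"
    using assms by (auto simp: corners_def)
  have same: "(h, T) \<in> corners r \<and> corner_adj (h, S) (h, T) \<longleftrightarrow>
      (\<exists>i\<in>directions r h. S \<noteq> {i} \<and> T = sym_diff S {i})" for T
  proof -
    have "corner_adj (h, S) (h, T) \<longleftrightarrow> (\<exists>i. T = sym_diff S {i})"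
      unfolding corner_adj_def using card_sym_diff_eq_1_iff by simp
    moreover have "(h, sym_diff S {i}) \<in> corners r \<longleftrightarrow> i \<in> directions r h \<and> S \<noteq> {i}" for i
      using S by (auto simp: corners_def)
    ultimately show ?thesis
      by metis
  qed
  have other: "(\<not> h, T) \<in> corners r \<and> corner_adj (h, S) (\<not> h, T) \<longleftrightarrow>
      (\<exists>j<r - 1. S = {j}) \<and> T = S" for T
  proof -
    have "corner_adj (h, S) (\<not> h, T) \<longleftrightarrow> (\<exists>j. S \<union> T = {j})"
      by (simp add: corner_adj_def card_1_singleton_iff)
    moreover have "T \<noteq> {} \<and> S \<union> T = {j} \<longleftrightarrow> T = S \<and> S = {j}" for j
      using S by (auto simp: Un_singleton_iff)
    \<comment> \<open>Here \<open>r \<ge> 1\<close> keeps the private directions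
      \<open>r - 1\<close> and \<open>r\<close> distinct; truncated subtraction would identify them
      for \<open>r = 0\<close>.\<close>
    moreover have "directions r h \<inter> directions r (\<not> h) = {..<r - 1}"
      using assms(1) by (auto simp: directions_def split: if_splits)
    moreover have "(\<not> h, T) \<in> corners r \<longleftrightarrow> T \<noteq> {} \<and> T \<subseteq> directions r (\<not> h)"
      by (simp add: corners_def)
    moreover have "S \<subseteq> directions r (\<not> h) \<longleftrightarrow> j < r - 1" if "S = {j}" for j
      using that S \<open>_ = {..<r - 1}\<close> by (metis IntI IntD2 insert_subset empty_subsetI lessThan_iff)
    ultimately show ?thesis
      by metis
  qed
  have "w \<in> corners r \<and> corner_adj (h, S) w \<longleftrightarrow>
      w \<in> (\<lambda>i. (h, sym_diff S {i})) ` {i \<in> directions r h. S \<noteq> {i}} \<union>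
      (if \<exists>j<r - 1. S = {j} then {(\<not> h, S)} else {})" for w
  proof (cases w)
    case (Pair g T)
    show ?thesis
    proof (cases "g = h")
      case True
      then show ?thesis
        using same[of T] Pair by auto
    next
      case False
      then have "g = (\<not> h)"
        by blast
      then show ?thesis
        using other[of T] Pair by auto
    qed
  qed
  then show ?thesis
    by (intro set_eqI) (simp only: mem_Collect_eq)
qed

text \<open>Of the \<open>r\<close> flips, a singleton loses the one to the origin. The edge to the
  other copy makes up for it at a shared direction, but not at the private one.\<close>

lemma card_corner_neighbours:
  assumes "r \<ge> 1" "(h, S) \<in> corners r"
  shows "card {w \<in> corners r. corner_adj (h, S) w} =
    (if S = {if h then r else r - 1} then r - 1 else r)"
proof -
  let ?D = "{i \<in> directions r h. S \<noteq> {i}}" and ?e = "if h then r else r - 1"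
  have S: "S \<noteq> {}" "S \<subseteq> directions r h"
    using assms by (auto simp: corners_def)
  have "inj_on (\<lambda>i. (h, sym_diff S {i})) ?D"
    using inj_sym_diff_singleton[of S] by (auto simp: inj_on_def)
  then have card: "card ((\<lambda>i. (h, sym_diff S {i})) ` ?D) = card ?D"
    by (rule card_image)
  consider "S = {?e}" | j where "j < r - 1" "S = {j}" | "\<nexists>j. S = {j}"
    using S unfolding directions_def by auto
  then show ?thesis
  proof cases
    case 1
    then have "?D = directions r h - {?e}"
      by auto
    moreover have "?e \<in> directions r h"
      by (simp add: directions_def)
    ultimately have "card ?D = r - 1"
      using card_directions[OF assms(1)] by (simp add: card_Diff_singleton)
    moreover have "\<not> (\<exists>j<r - 1. S = {j})"
      using 1 by auto
    ultimately show ?thesis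
      unfolding corner_neighbours[OF assms] using 1 card by simp
  next
    case 2
    then have "?D = directions r h - {j}" "j \<in> directions r h"
      by (auto simp: directions_def)
    then have "card ?D = r - 1"
      using card_directions[OF assms(1)] by (simp add: card_Diff_singleton)
    moreover have "(\<not> h, S) \<notin> (\<lambda>i. (h, sym_diff S {i})) ` ?D"
      by auto
    moreover have "S \<noteq> {?e}"
      using 2 by auto
    moreover have "\<exists>j<r - 1. S = {j}"
      using 2 by auto
    ultimately show ?thesis
      unfolding corner_neighbours[OF assms] using card assms(1)
      by (simp add: finite_directions)
  next
    case 3
    then have "?D = directions r h"
      by auto
    moreover have "\<not> (\<exists>j<r - 1. S = {j})" "S \<noteq> {?e}"
      using 3 by auto
    ultimately show ?thesis
      unfolding corner_neighbours[OF assms] using card card_directions[OF assms(1)] by auto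
  qed
qed

section \<open>Drawing the abstract graph in the complex plane\<close>

lemma corner_drawing:
  "\<exists>u. inj_on (corner_pos u) (corners r) \<and>
    (\<forall>v\<in>corners r. \<forall>w\<in>corners r. dist (corner_pos u v) (corner_pos u w) = 1 \<longleftrightarrow> corner_adj v w)"
proof -
  define z where "z h = (if h then cis (pi / 3) else 1)" for h
  \<comment> \<open>These are all differences of a coefficient 0 or \<open>z h\<close> and a
    coefficient 0 or \<open>z g\<close>; each is zero or of norm 1, as genericity requires.\<close>
  define C where "C = {0, 1, cis (pi / 3), - 1, - cis (pi / 3), 1 - cis (pi / 3), cis (pi / 3) - 1}"
  have norm_z: "norm (1 - cis (pi / 3)) = 1" "norm (cis (pi / 3) - 1) = 1"
    using norm_1_minus_cis_pi_third norm_minus_commute by metis+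
  have "finite C" "\<And>c. c \<in> C \<Longrightarrow> c = 0 \<or> norm c = 1"
    using norm_z by (auto simp: C_def)
  \<comment> \<open>The directions of both copies together run from 0 to \<open>r\<close>, hence
    \<open>Suc r\<close> vectors.\<close>
  from generic_unit_vectors[OF this, of "Suc r"] obtain u where
    u: "\<And>c. \<forall>i<Suc r. c i \<in> C \<Longrightarrow>
      ((\<Sum>i<Suc r. c i * u i) = 0 \<longleftrightarrow> card {i. i < Suc r \<and> c i \<noteq> 0} = 0) \<and>
      (norm (\<Sum>i<Suc r. c i * u i) = 1 \<longleftrightarrow> card {i. i < Suc r \<and> c i \<noteq> 0} = 1)"
    by blast
  define D where "D v w = (if fst v = fst w then sym_diff (snd v) (snd w) else snd v \<union> snd w)"
    for v w :: "bool \<times> nat set"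
  have key: "(corner_pos u v = corner_pos u w \<longleftrightarrow> card (D v w) = 0) \<and>
      (dist (corner_pos u v) (corner_pos u w) = 1 \<longleftrightarrow> card (D v w) = 1)"
    if "v \<in> corners r" "w \<in> corners r" for v w
  proof -
    obtain h S g T where vw: "v = (h, S)" "w = (g, T)"
      by (metis surj_pair)
    have ST: "S \<subseteq> {..<Suc r}" "T \<subseteq> {..<Suc r}"
      using that by (auto simp: vw corners_def directions_def split: if_splits)
    define c where "c i = (if i \<in> S then z h else 0) - (if i \<in> T then z g else 0)" for i
    have pos: "corner_pos u (k, A) = (\<Sum>i<Suc r. (if i \<in> A then z k else 0) * u i)"
      if "A \<subseteq> {..<Suc r}" for k A
    proof -
      have "(\<Sum>i<Suc r. (if i \<in> A then z k else 0) * u i) = (\<Sum>i\<in>A. z k * u i)"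
        using that by (intro sum.mono_neutral_cong_right) auto
      then show ?thesis
        by (simp add: corner_pos_def z_def sum_distrib_left)
    qed
    have diff: "corner_pos u v - corner_pos u w = (\<Sum>i<Suc r. c i * u i)"
      unfolding vw pos[OF ST(1)] pos[OF ST(2)] c_def
      by (simp only: sum_subtractf[symmetric] left_diff_distrib)
    have ne: "cis (pi / 3) \<noteq> 1" "1 \<noteq> cis (pi / 3)"
      using norm_z by auto
    have "\<forall>i<Suc r. c i \<in> C"
      by (auto simp: c_def z_def C_def)
    moreover have "{i. i < Suc r \<and> c i \<noteq> 0} = D v w"
      using ST ne by (auto simp: c_def z_def D_def vw split: if_splits)
    ultimately show ?thesis
      using u[of c] unfolding dist_norm diff[symmetric] by simp
  qed
  have "v = w" if "v \<in> corners r" "w \<in> corners r" "corner_pos u v = corner_pos u w" for v w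
  proof -
    \<comment> \<open>Infinite sets also have \<open>card\<close> 0, so finiteness is needed to
      conclude that \<open>D v w\<close> is empty. Across copies this contradicts that corners are
      nonempty sets.\<close>
    have "finite (snd v)" "finite (snd w)" "snd v \<noteq> {}"
      using that finite_subset[OF _ finite_directions] by (auto simp: corners_def)
    moreover have "card (D v w) = 0"
      using key that by blast
    ultimately show ?thesis
      by (auto simp: D_def prod_eq_iff split: if_splits)
  qed
  then have "inj_on (corner_pos u) (corners r)"
    by (rule inj_onI)
  moreover have "corner_adj v w \<longleftrightarrow> card (D v w) = 1" for v w
    by (simp only: corner_adj_def D_def)
  ultimately show ?thesis
    using key by (intro exI[of _ u]) simp
qed

section \<open>Transfer to the real plane and conclusion\<close>

lemma complex_real2_isometry:
  "\<exists>f :: complex \<Rightarrow> real^2. \<forall>x y. dist (f x) (f y) = dist x y"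
proof (intro exI allI)
  fix x y :: complex
  show "dist (vector [Re x, Im x] :: real^2) (vector [Re y, Im y]) = dist x y"
    by (simp add: dist_vec_def L2_set_def sum_2 dist_norm cmod_def)
qed

theorem theorem2p2:
  fixes r :: nat
  assumes "r \<ge> 2"
  shows "\<exists>(J :: (real^2) pair_pre_digraph) a b.
    pair_graph J \<and> induced_unit_distance_graph J \<and>
    a \<in> pverts J \<and> b \<in> pverts J \<and> a \<noteq> b \<and> (a, b) \<notin> parcs J \<and>
    out_degree (with_proj J) a = r - 1 \<and> out_degree (with_proj J) b = r - 1 \<and>
    (\<forall>v \<in> pverts J - {a, b}. out_degree (with_proj J) v = r)"
proof -
  obtain u where u: "inj_on (corner_pos u) (corners r)"
    "\<And>v w. v \<in> corners r \<Longrightarrow> w \<in> corners r \<Longrightarrow>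
      dist (corner_pos u v) (corner_pos u w) = 1 \<longleftrightarrow> corner_adj v w"
    using corner_drawing by blast
  obtain f :: "complex \<Rightarrow> real^2" where f: "\<And>x y. dist (f x) (f y) = dist x y"
    using complex_real2_isometry by blast
  define F where "F = f \<circ> corner_pos u"
  have "inj f"
    using f by (metis dist_eq_0_iff injI)
  then have inj: "inj_on F (corners r)"
    unfolding F_def using u(1) by (simp add: comp_inj_on inj_on_subset)
  have adj: "dist (F v) (F w) = 1 \<longleftrightarrow> corner_adj v w" if "v \<in> corners r" "w \<in> corners r" for v w
    using that u(2) f by (simp add: F_def)
  \<comment> \<open>The vertices are the drawn points themselves, so the identity serves as the
    drawing.\<close>
  define J where
    "J = \<lparr> pverts = F ` corners r,
           parcs = {(x, y). x \<in> F ` corners r \<and> y \<in> F ` corners r \<and> dist x y = 1} \<rparr>"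
  have fin: "finite (F ` corners r)"
    using finite_corners by simp
  have "pair_graph J"
  proof
    show "finite (pverts J)"
      using fin by (simp add: J_def)
    show "finite (parcs J)"
      by (rule finite_subset[of _ "F ` corners r \<times> F ` corners r"]) (use fin in \<open>auto simp: J_def\<close>)
    show "symmetric (with_proj J)"
      by (auto simp: symmetric_def J_def arcs_ends_def sym_def arc_to_ends_def dist_commute image_iff)
  qed (auto simp: J_def)
  then interpret J: pair_graph J .
  have "induced_unit_distance_graph J"
    unfolding induced_unit_distance_graph_iff_drawing[OF J.pair_wf_digraph_axioms]
    by (intro exI[of _ id]) (auto simp: J_def)
  have deg: "out_degree (with_proj J) (F (h, S)) = (if S = {if h then r else r - 1} then r - 1 else r)"
    if v: "(h, S) \<in> corners r" for h S
  proof -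
    have "out_arcs (with_proj J) (F (h, S)) =
        (\<lambda>w. (F (h, S), F w)) ` {w \<in> corners r. corner_adj (h, S) w}"
      using v adj by (auto simp: out_arcs_def J_def)
    moreover have "inj_on (\<lambda>w. (F (h, S), F w)) {w \<in> corners r. corner_adj (h, S) w}"
      using inj by (auto simp: inj_on_def)
    ultimately show ?thesis
      using card_corner_neighbours[OF _ v] assms by (simp add: out_degree_def card_image)
  qed
  \<comment> \<open>These are the two private singletons, the only corners whose lost edge is not
    replaced. They lie in different copies and their union \<open>{r - 1, r}\<close> has two
    elements, so they are not adjacent.\<close>
  let ?a = "(False, {r - 1})" and ?b = "(True, {r})"
  have ab: "?a \<in> corners r" "?b \<in> corners r"
    by (auto simp: corners_def directions_def)
  have "F ?a \<noteq> F ?b"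
    using ab inj by (auto dest: inj_onD)
  moreover have "(F ?a, F ?b) \<notin> parcs J"
    using ab adj assms by (auto simp: J_def corner_adj_def)
  moreover have "out_degree (with_proj J) x = r" if "x \<in> pverts J - {F ?a, F ?b}" for x
  proof -
    obtain h S where x: "x = F (h, S)" "(h, S) \<in> corners r"
      using \<open>x \<in> _\<close> by (auto simp: J_def)
    then have "S \<noteq> {if h then r else r - 1}"
      using \<open>x \<in> _\<close> by auto
    then show ?thesis
      using deg x by simp
  qed
  moreover have "F ?a \<in> pverts J" "F ?b \<in> pverts J"
    using ab by (auto simp: J_def)
  ultimately show ?thesis
    using \<open>pair_graph J\<close> \<open>induced_unit_distance_graph J\<close> deg[OF ab(1)] deg[OF ab(2)]
    by (intro exI[of _ J] exI[of _ "F ?a"] exI[of _ "F ?b"] conjI ballI) simp_all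
qed

end
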